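(* Let $(X,\leq)$ be a partially ordered set endowed with a metric $d$ such that $(X,d)$ is complete, let $\varepsilon>0$ and $\lambda\in(0,1)$, and let $F:X\times X\to X$ be a mapping. Assume that: 1. $X$ is $\varepsilon$-chainable with respect to the partial order $\leq$; 2. if $\{x_m\}$ is a nondecreasing sequence in $X$ such that $x_m\to x$ in $(X,d)$ as $m\to+\infty$, then $x_m\leq x$ for all $m$; 3. if $\{y_m\}$ is a nonincreasing sequence in $X$ such that $y_m\to y$ in $(X,d)$ as $m\to+\infty$, then $y_m\geq y$ for all $m$; 4. $F$ has the mixed monotone property; 5. $F$ is $(\varepsilon,\lambda)$ uniformly locally contractive; 6. there exist $x_0,y_0\in X$ such that $x_0\leq F(x_0,y_0)$ and $y_0\geq F(y_0,x_0)$. Then $F$ admits a coupled fixed point, i.e. there exists $(x,y)\in X\times X$ with $F(x,y)=x$ and $F(y,x)=y$.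
   Context: Let $(X,\leq)$ be a partially ordered set endowed with a metric $d$ and let $F:X\times X\to X$. $X$ is $\varepsilon$-chainable with respect to $\leq$ ($\varepsilon>0$) if for any $a,b\in X$ with $a\leq b$ there exist an integer $n\geq 1$ and points $a=\alpha_0\leq\alpha_1\leq\cdots\leq\alpha_{n-1}\leq\alpha_n=b$ of $X$ such that $d(\alpha_{i-1},\alpha_i)<\varepsilon$ for all $i=1,\dots,n$. $F$ has the mixed monotone property if for all $x,y\in X$: $x_1\leq x_2$ in $X$ implies $F(x_1,y)\leq F(x_2,y)$, and $y_1\leq y_2$ in $X$ implies $F(x,y_1)\geq F(x,y_2)$. $F$ is $(\varepsilon,\lambda)$ uniformly locally contractive ($\varepsilon>0$, $\lambda\in(0,1)$) if for all $x,y,u,v\in X$ with $x\geq u$, $y\leq v$ and $(x,y)\neq(u,v)$: $\frac{d(x,u)+d(y,v)}{2}<\varepsilon$ implies $d(F(x,y),F(u,v))<\frac{\lambda}{2}[d(x,u)+d(y,v)]$. *)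

theory Defs
  imports Complex_Main
begin

definition eps_chainable :: "real \<Rightarrow> 'a::{order, metric_space} itself \<Rightarrow> bool" where
  "eps_chainable \<epsilon> (_ :: 'a itself) \<longleftrightarrow>
    (\<forall>a b :: 'a. a \<le> b \<longrightarrow>
      (\<exists>n::nat. n \<ge> 1 \<and> (\<exists>\<alpha> :: nat \<Rightarrow> 'a. \<alpha> 0 = a \<and> \<alpha> n = b \<and>
        (\<forall>i\<in>{1..n}. \<alpha> (i - 1) \<le> \<alpha> i \<and> dist (\<alpha> (i - 1)) (\<alpha> i) < \<epsilon>))))"

definition mixed_monotone :: "('a::order \<times> 'a \<Rightarrow> 'a) \<Rightarrow> bool" where
  "mixed_monotone F \<longleftrightarrow>
    (\<forall>x y.
      (\<forall>x1 x2. x1 \<le> x2 \<longrightarrow> F (x1, y) \<le> F (x2, y)) \<and>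
      (\<forall>y1 y2. y1 \<le> y2 \<longrightarrow> F (x, y1) \<ge> F (x, y2)))"

definition uniformly_locally_contractive ::
  "real \<Rightarrow> real \<Rightarrow> ('a::{order, metric_space} \<times> 'a \<Rightarrow> 'a) \<Rightarrow> bool" where
  "uniformly_locally_contractive \<epsilon> lam F \<longleftrightarrow>
    (\<forall>x y u v. x \<ge> u \<longrightarrow> y \<le> v \<longrightarrow> (x, y) \<noteq> (u, v) \<longrightarrow>
      (dist x u + dist y v) / 2 < \<epsilon> \<longrightarrow>
      dist (F (x, y)) (F (u, v)) < lam / 2 * (dist x u + dist y v))"

definition coupled_fixed_point :: "('a \<times> 'a \<Rightarrow> 'a) \<Rightarrow> 'a \<times> 'a \<Rightarrow> bool" where
  "coupled_fixed_point F = (\<lambda>(x, y). F (x, y) = x \<and> F (y, x) = y)"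

end

theory Submission
  imports Defs
begin

text \<open>
  The pair map \<open>T (x, y) = (F (x, y), F (y, x))\<close> has exactly the coupled fixed points of \<open>F\<close> as
  its fixed points. Order pairs by \<open>(u, v) \<sqsubseteq> (x, y)\<close> iff \<open>u \<le> x\<close> and \<open>y \<le> v\<close>, and measure them
  by the mean of the two coordinate distances. Mixed monotonicity says that \<open>T\<close> is monotone for
  this order, and the local contraction hypothesis, used once for each coordinate, says that \<open>T\<close>
  shrinks the mean distance of comparable pairs that are less than \<open>\<epsilon>\<close> apart by the factor
  \<open>lam\<close>. The problem is thus one about a single monotone map.

  The starting pair \<open>p = (x0, y0)\<close> satisfies \<open>p \<sqsubseteq> T p\<close>, but \<open>p\<close> and \<open>T p\<close> may be far apart.
  Chainability repairs this: a chain of short comparable steps from \<open>p\<close> to \<open>T p\<close> is contracted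
  step by step under iteration of \<open>T\<close>, so the distance of the \<open>k\<close>-th iterates of \<open>p\<close> and \<open>T p\<close> is
  at most a constant times \<open>lam ^ k\<close> (\<open>iterates_geometrically_close\<close>). Hence the orbit of \<open>p\<close>
  is a Cauchy sequence, increasing in the first coordinate and decreasing in the second. Its
  limit \<open>q\<close> lies above the whole orbit by the two hypotheses on monotone sequences. The orbit is
  eventually within \<open>\<epsilon>\<close> of \<open>q\<close>, so the contraction estimate applies to orbit points and \<open>q\<close>;
  it shows that \<open>T\<close> maps the orbit to a sequence converging to \<open>T q\<close>, and \<open>T q = q\<close> follows.
\<close>

section \<open>The pair map as a monotone local contraction\<close>

definition coupled_map :: "('a \<times> 'a \<Rightarrow> 'a) \<Rightarrow> 'a \<times> 'a \<Rightarrow> 'a \<times> 'a" where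
  "coupled_map F p = (F p, F (snd p, fst p))"

definition mixed_le :: "'a::order \<times> 'a \<Rightarrow> 'a \<times> 'a \<Rightarrow> bool" where
  "mixed_le p q \<longleftrightarrow> fst p \<le> fst q \<and> snd q \<le> snd p"

text \<open>
  This is not the Euclidean distance of the product type, but the quantity that the contraction
  hypothesis compares with \<open>\<epsilon>\<close>, so that the threshold and the factor carry over to pairs unchanged.
\<close>

definition mean_dist :: "'a::metric_space \<times> 'a \<Rightarrow> 'a \<times> 'a \<Rightarrow> real" where
  "mean_dist p q = (dist (fst p) (fst q) + dist (snd p) (snd q)) / 2"

lemma mean_dist_triangle: "mean_dist p r \<le> mean_dist p q + mean_dist q r"
  using dist_triangle[of "fst p" "fst r" "fst q"] dist_triangle[of "snd p" "snd r" "snd q"]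
  unfolding mean_dist_def by argo

lemma mean_dist_commute: "mean_dist p q = mean_dist q p"
  by (simp add: mean_dist_def dist_commute)

lemma coupled_map_mono:
  assumes "mixed_monotone F" and "mixed_le p q"
  shows "mixed_le (coupled_map F p) (coupled_map F q)"
proof -
  have F_mono: "F (a, b) \<le> F (c, d)" if "a \<le> c" "d \<le> b" for a b c d
    using assms(1) that unfolding mixed_monotone_def
    by (auto intro: order_trans[where y = "F (c, b)"])
  show ?thesis
    using assms(2) F_mono[of "fst p" "fst q" "snd q" "snd p"] F_mono[of "snd q" "snd p" "fst p" "fst q"]
    by (simp add: mixed_le_def coupled_map_def)
qed

lemma coupled_map_iterate_mono:
  assumes "mixed_monotone F" and "mixed_le p q"
  shows "mixed_le ((coupled_map F ^^ k) p) ((coupled_map F ^^ k) q)"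
  by (induction k) (simp_all add: assms coupled_map_mono)

text \<open>
  The second coordinate of the image is \<open>F\<close> at the swapped pairs. Swapping reverses
  the order of pairs and leaves their mean distance unchanged, so the contraction hypothesis
  bounds this coordinate too. The bound is weak because equal pairs are now included.
\<close>

lemma coupled_map_contracts:
  assumes contr: "uniformly_locally_contractive \<epsilon> lam F"
    and le: "mixed_le p q" and close: "mean_dist p q < \<epsilon>"
  shows "mean_dist (coupled_map F p) (coupled_map F q) \<le> lam * mean_dist p q"
proof -
  have bound: "dist (F (x, y)) (F (u, v)) \<le> lam / 2 * (dist x u + dist y v)"
    if "u \<le> x" "y \<le> v" "(dist x u + dist y v) / 2 < \<epsilon>" for x y u v
    using contr that unfolding uniformly_locally_contractive_def
    by (cases "(x, y) = (u, v)") (auto intro: less_imp_le)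
  have "dist (F q) (F p) \<le> lam * mean_dist p q"
    using bound[of "fst p" "fst q" "snd q" "snd p"] le close
    by (simp add: mixed_le_def mean_dist_def dist_commute)
  moreover have "dist (F (snd p, fst p)) (F (snd q, fst q)) \<le> lam * mean_dist p q"
    using bound[of "snd q" "snd p" "fst p" "fst q"] le close
    by (simp add: mixed_le_def mean_dist_def add.commute)
  moreover have "mean_dist (coupled_map F p) (coupled_map F q)
      = (dist (F q) (F p) + dist (F (snd p, fst p)) (F (snd q, fst q))) / 2"
    by (simp add: mean_dist_def coupled_map_def dist_commute)
  ultimately show ?thesis by simp
qed

lemma iterates_close_of_close:
  assumes "0 < lam" and "lam < 1"
    and mono: "mixed_monotone F" and contr: "uniformly_locally_contractive \<epsilon> lam F"
    and le: "mixed_le p q" and close: "mean_dist p q < \<epsilon>"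
  shows "mean_dist ((coupled_map F ^^ k) p) ((coupled_map F ^^ k) q) \<le> mean_dist p q * lam ^ k"
proof (induction k)
  case (Suc k)
  have "mean_dist p q * lam ^ k \<le> mean_dist p q"
    using assms(1,2) by (simp add: mean_dist_def mult_left_le power_le_one)
  hence "mean_dist ((coupled_map F ^^ k) p) ((coupled_map F ^^ k) q) < \<epsilon>"
    using Suc.IH close by linarith
  hence "mean_dist ((coupled_map F ^^ Suc k) p) ((coupled_map F ^^ Suc k) q)
      \<le> lam * mean_dist ((coupled_map F ^^ k) p) ((coupled_map F ^^ k) q)"
    using coupled_map_contracts[OF contr coupled_map_iterate_mono[OF mono le]] by simp
  also have "\<dots> \<le> lam * (mean_dist p q * lam ^ k)"
    using Suc.IH assms(1) by simp
  finally show ?case by (simp add: mult_ac)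
qed simp

section \<open>Contraction along chains\<close>

text \<open>
  Having iterates at geometrically decreasing distance is a transitive relation between pairs,
  by the triangle inequality. It therefore spreads from pairs less than \<open>\<epsilon>\<close> apart to all
  comparable pairs: move the first coordinate along a chain, then the second. Moving one
  coordinate at a time avoids aligning two chains of different lengths.
\<close>

lemma iterates_geometrically_close:
  assumes lam: "0 < lam" "lam < 1"
    and chain: "eps_chainable \<epsilon> TYPE('a::{order, metric_space})"
    and mono: "mixed_monotone F" and contr: "uniformly_locally_contractive \<epsilon> lam F"
    and le: "mixed_le p (q :: 'a \<times> 'a)"
  shows "\<exists>C. \<forall>k. mean_dist ((coupled_map F ^^ k) p) ((coupled_map F ^^ k) q) \<le> C * lam ^ k"
proof -
  define geom where "geom p q \<longleftrightarrow>
    (\<exists>C. \<forall>k. mean_dist ((coupled_map F ^^ k) p) ((coupled_map F ^^ k) q) \<le> C * lam ^ k)"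
    for p q :: "'a \<times> 'a"
  have trans: "geom p r" if pq: "geom p q" and qr: "geom q r" for p q r
  proof -
    obtain C where C: "mean_dist ((coupled_map F ^^ k) p) ((coupled_map F ^^ k) q) \<le> C * lam ^ k" for k
      using pq unfolding geom_def by blast
    obtain D where D: "mean_dist ((coupled_map F ^^ k) q) ((coupled_map F ^^ k) r) \<le> D * lam ^ k" for k
      using qr unfolding geom_def by blast
    have "mean_dist ((coupled_map F ^^ k) p) ((coupled_map F ^^ k) r) \<le> (C + D) * lam ^ k" for k
      using mean_dist_triangle[of "(coupled_map F ^^ k) p" "(coupled_map F ^^ k) r" "(coupled_map F ^^ k) q"]
        C[of k] D[of k] by (simp add: distrib_right)
    thus ?thesis unfolding geom_def by blast
  qed
  have step: "geom p q" if "mixed_le p q" "mean_dist p q < \<epsilon>" for p q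
    using iterates_close_of_close[OF lam mono contr that] unfolding geom_def by blast
  have refl: "geom p p" for p
    unfolding geom_def by (rule exI[of _ 0]) (simp add: mean_dist_def)
  have spread: "R a b"
    if "a \<le> b" and R_refl: "\<And>x. R x x" and R_trans: "\<And>x y z. R x y \<Longrightarrow> R y z \<Longrightarrow> R x z"
      and R_step: "\<And>x y. x \<le> y \<Longrightarrow> dist x y < \<epsilon> \<Longrightarrow> R x y" for R and a b :: 'a
  proof -
    obtain n :: nat where "n \<ge> 1 \<and> (\<exists>\<alpha>. \<alpha> 0 = a \<and> \<alpha> n = b \<and>
        (\<forall>i\<in>{1..n}. \<alpha> (i - 1) \<le> \<alpha> i \<and> dist (\<alpha> (i - 1)) (\<alpha> i) < \<epsilon>))"
      using chain[unfolded eps_chainable_def, THEN spec, THEN spec, THEN mp, OF \<open>a \<le> b\<close>]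
      by (rule exE)
    then obtain \<alpha> where \<alpha>: "\<alpha> 0 = a \<and> \<alpha> n = b \<and>
        (\<forall>i\<in>{1..n}. \<alpha> (i - 1) \<le> \<alpha> i \<and> dist (\<alpha> (i - 1)) (\<alpha> i) < \<epsilon>)"
      by (elim conjE[of _ "Ex _"] exE)
    have links: "\<alpha> i \<le> \<alpha> (Suc i) \<and> dist (\<alpha> i) (\<alpha> (Suc i)) < \<epsilon>" if "i < n" for i
      using bspec[OF \<alpha>[THEN conjunct2, THEN conjunct2], of "Suc i"] that by simp
    have "R (\<alpha> 0) (\<alpha> i)" if "i \<le> n" for i
      using that
    proof (induction i)
      case (Suc i)
      have "R (\<alpha> i) (\<alpha> (Suc i))"
        using links[of i] Suc.prems by (intro R_step) simp_all
      moreover have "R (\<alpha> 0) (\<alpha> i)" using Suc by simp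
      ultimately show ?case by (rule R_trans[rotated])
    qed (rule R_refl)
    thus ?thesis using \<alpha> by blast
  qed
  obtain x y u v where p: "p = (x, y)" and q: "q = (u, v)" by (cases p, cases q)
  have "geom (x, y) (u, y)"
  proof (rule spread[where R = "\<lambda>a b. geom (a, y) (b, y)"])
    show "x \<le> u" using le p q by (simp add: mixed_le_def)
    show "geom (a, y) (c, y)" if "geom (a, y) (b, y)" "geom (b, y) (c, y)" for a b c
      using that by (rule trans)
    show "geom (a, y) (b, y)" if "a \<le> b" "dist a b < \<epsilon>" for a b
      using that zero_le_dist[of a b] by (intro step) (simp_all add: mixed_le_def mean_dist_def del: zero_le_dist)
  qed (rule refl)
  \<comment> \<open>In the second coordinate the pair order is reversed, so a chain from \<open>v\<close> up to \<open>y\<close> is read backwards.\<close>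
  moreover have "geom (u, y) (u, v)"
  proof (rule spread[where R = "\<lambda>a b. geom (u, b) (u, a)"])
    show "v \<le> y" using le p q by (simp add: mixed_le_def)
    show "geom (u, c) (u, a)" if "geom (u, b) (u, a)" "geom (u, c) (u, b)" for a b c
      using that(2,1) by (rule trans)
    show "geom (u, b) (u, a)" if "a \<le> b" "dist a b < \<epsilon>" for a b
      using that zero_le_dist[of a b]
      by (intro step) (simp_all add: mixed_le_def mean_dist_def dist_commute del: zero_le_dist)
  qed (rule refl)
  ultimately have "geom p q" unfolding p q by (rule trans)
  thus ?thesis unfolding geom_def .
qed

section \<open>Convergence of orbits and fixed points\<close>

text \<open>
  Summing the geometric series from \<open>m\<close> on bounds the distance of \<open>X m\<close> to every later term by
  \<open>C / (1 - lam) * lam ^ m\<close>, so \<open>X\<close> is a Cauchy sequence. The induction on the later index keeps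
  the exact partial sum, since the closed bound alone is not inductive.
\<close>

lemma convergent_if_geometric_steps:
  fixes X :: "nat \<Rightarrow> 'a::complete_space"
  assumes lam: "0 < lam" "lam < 1"
    and steps: "\<And>k. dist (X k) (X (Suc k)) \<le> C * lam ^ k"
  shows "convergent X"
proof -
  have far: "dist (X m) (X (m + j)) \<le> C / (1 - lam) * lam ^ m" for m j
  proof -
    have "dist (X m) (X (m + j)) \<le> C / (1 - lam) * (lam ^ m - lam ^ (m + j))"
    proof (induction j)
      case (Suc j)
      have "C * lam ^ (m + j) = C / (1 - lam) * (lam ^ (m + j) - lam ^ (m + Suc j))"
        using lam by (simp add: field_simps)
      hence "dist (X m) (X (m + Suc j)) \<le> C / (1 - lam) * (lam ^ m - lam ^ (m + j))
          + C / (1 - lam) * (lam ^ (m + j) - lam ^ (m + Suc j))"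
        using dist_triangle[of "X m" "X (m + Suc j)" "X (m + j)"] Suc.IH steps[of "m + j"] by simp
      thus ?case by (simp add: right_diff_distrib)
    qed simp
    also have "\<dots> \<le> C / (1 - lam) * lam ^ m"
    proof (rule mult_left_mono)
      have "0 \<le> C"
        using order_trans[OF zero_le_dist steps[of 0]] by simp
      thus "0 \<le> C / (1 - lam)" using lam by simp
    qed (use lam in simp)
    finally show ?thesis .
  qed
  have "(\<lambda>m. C / (1 - lam) * lam ^ m) \<longlonglongrightarrow> C / (1 - lam) * 0"
    using lam by (intro tendsto_mult_left LIMSEQ_realpow_zero) auto
  hence small: "\<exists>M. \<forall>m\<ge>M. C / (1 - lam) * lam ^ m < e" if "e > 0" for e
    using order_tendstoD(2)[of _ 0 sequentially e] that by (simp add: eventually_sequentially)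
  have "Cauchy X"
  proof (rule CauchyI')
    fix e :: real assume "e > 0"
    then obtain M where M: "\<forall>m\<ge>M. C / (1 - lam) * lam ^ m < e" using small by blast
    have "dist (X m) (X n) < e" if "m \<ge> M" "n > m" for m n
      using far[of m "n - m"] M that by fastforce
    thus "\<exists>M. \<forall>m\<ge>M. \<forall>n>m. dist (X m) (X n) < e" by blast
  qed
  thus ?thesis by (rule Cauchy_convergent)
qed

text \<open>
  Contraction acts only between comparable pairs, so the limit of an orbit can be compared with
  its image only because the limit lies above the orbit.
\<close>

lemma coupled_map_limit_fixed:
  assumes "\<epsilon> > 0" and contr: "uniformly_locally_contractive \<epsilon> lam F"
    and orbit: "\<And>k. z (Suc k) = coupled_map F (z k)"
    and below: "\<And>k. mixed_le (z k) q"
    and lim: "(\<lambda>k. mean_dist (z k) q) \<longlonglongrightarrow> 0"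
  shows "coupled_map F q = q"
proof -
  have "\<forall>\<^sub>F k in sequentially. mean_dist (z k) q < \<epsilon>"
    using lim \<open>\<epsilon> > 0\<close> by (rule order_tendstoD(2))
  hence "\<forall>\<^sub>F k in sequentially.
      mean_dist (coupled_map F q) q \<le> lam * mean_dist (z k) q + mean_dist (z (Suc k)) q"
  proof eventually_elim
    case (elim k)
    have "mean_dist (coupled_map F q) q \<le> mean_dist (coupled_map F q) (z (Suc k)) + mean_dist (z (Suc k)) q"
      by (rule mean_dist_triangle)
    thus ?case
      using coupled_map_contracts[OF contr below elim]
      by (simp add: orbit mean_dist_commute[of "coupled_map F q"])
  qed
  moreover have "(\<lambda>k. lam * mean_dist (z k) q + mean_dist (z (Suc k)) q) \<longlonglongrightarrow> lam * 0 + 0"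
    using lim by (intro tendsto_intros LIMSEQ_Suc)
  ultimately have "mean_dist (coupled_map F q) q \<le> 0"
    using tendsto_lowerbound by fastforce
  hence "dist (fst (coupled_map F q)) (fst q) + dist (snd (coupled_map F q)) (snd q) \<le> 0"
    by (simp add: mean_dist_def)
  hence "fst (coupled_map F q) = fst q" "snd (coupled_map F q) = snd q"
    by (simp_all add: add_nonneg_eq_0_iff antisym_conv)
  thus ?thesis by (rule prod_eqI)
qed

theorem theorem2p2:
  fixes F :: "'a::{order, complete_space} \<times> 'a \<Rightarrow> 'a"
    and \<epsilon> lam :: real
  assumes "\<epsilon> > 0"
    and "0 < lam" and "lam < 1"
    and "eps_chainable \<epsilon> TYPE('a)"
    and "\<And>(X :: nat \<Rightarrow> 'a) x. incseq X \<Longrightarrow> X \<longlonglongrightarrow> x \<Longrightarrow> (\<forall>m. X m \<le> x)"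
    and "\<And>(Y :: nat \<Rightarrow> 'a) y. decseq Y \<Longrightarrow> Y \<longlonglongrightarrow> y \<Longrightarrow> (\<forall>m. Y m \<ge> y)"
    and "mixed_monotone F"
    and "uniformly_locally_contractive \<epsilon> lam F"
    and "\<exists>x0 y0. x0 \<le> F (x0, y0) \<and> y0 \<ge> F (y0, x0)"
  shows "\<exists>p. coupled_fixed_point F p"
proof -
  obtain x0 y0 where "x0 \<le> F (x0, y0)" "F (y0, x0) \<le> y0" using assms(9) by blast
  define p where "p = (x0, y0)"
  have p: "mixed_le p (coupled_map F p)"
    using \<open>x0 \<le> F (x0, y0)\<close> \<open>F (y0, x0) \<le> y0\<close> by (simp add: p_def mixed_le_def coupled_map_def)
  define z where "z k = (coupled_map F ^^ k) p" for k
  have z_Suc: "z (Suc k) = coupled_map F (z k)" for k by (simp add: z_def)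
  have z_Suc': "z (Suc k) = (coupled_map F ^^ k) (coupled_map F p)" for k
    by (simp add: z_def funpow_swap1)
  have mono: "mixed_le (z k) (z (Suc k))" for k
    using coupled_map_iterate_mono[OF assms(7) p] z_Suc' by (simp add: z_def)
  obtain C where C: "mean_dist (z k) (z (Suc k)) \<le> C * lam ^ k" for k
    using iterates_geometrically_close[OF assms(2-4,7,8) p]
    unfolding z_Suc'[symmetric] z_def[symmetric] by blast
  \<comment> \<open>Each coordinate distance is at most twice the mean distance.\<close>
  have fst_step: "dist (fst (z k)) (fst (z (Suc k))) \<le> (2 * C) * lam ^ k"
    and snd_step: "dist (snd (z k)) (snd (z (Suc k))) \<le> (2 * C) * lam ^ k" for k
    using C[of k] zero_le_dist[of "fst (z k)" "fst (z (Suc k))"]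
      zero_le_dist[of "snd (z k)" "snd (z (Suc k))"] unfolding mean_dist_def mult.assoc by - argo+
  have "convergent (\<lambda>k. fst (z k))" "convergent (\<lambda>k. snd (z k))"
    by (rule convergent_if_geometric_steps[OF assms(2,3)], rule fst_step snd_step)+
  then obtain x y where x: "(\<lambda>k. fst (z k)) \<longlonglongrightarrow> x" and y: "(\<lambda>k. snd (z k)) \<longlonglongrightarrow> y"
    unfolding convergent_def by blast
  have "incseq (\<lambda>k. fst (z k))" "decseq (\<lambda>k. snd (z k))"
    using mono by (auto simp: mixed_le_def incseq_Suc_iff decseq_Suc_iff)
  hence below: "mixed_le (z k) (x, y)" for k
    using assms(5)[OF _ x] assms(6)[OF _ y] by (simp add: mixed_le_def)
  have "(\<lambda>k. (dist (fst (z k)) x + dist (snd (z k)) y) / 2) \<longlonglongrightarrow> (dist x x + dist y y) / 2"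
    by (intro tendsto_intros x y) simp
  hence lim: "(\<lambda>k. mean_dist (z k) (x, y)) \<longlonglongrightarrow> 0" by (simp add: mean_dist_def)
  have "coupled_map F (x, y) = (x, y)"
    using assms(1,8) z_Suc below lim by (rule coupled_map_limit_fixed)
  hence "coupled_fixed_point F (x, y)"
    by (simp add: coupled_map_def coupled_fixed_point_def)
  thus ?thesis by blast
qed

end
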